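(* Let $\Theta=(\Sigma,\mathit{sim},\mathit{ser})$ be a comtrace alphabet with $\mathit{sim}\setminus\mathit{ser}=\emptyset$ (a radical comtrace alphabet), let $\tau$ be a comtrace over $\Theta$ and let $\sigma$ be the step trace over the concurrent alphabet $(\Sigma,\mathit{ind})$ containing some (equivalently every) step sequence of $\tau$. Then $(\Sigma\times\Sigma)\setminus\mathit{ind}=\mathit{dep}$ and $\Pi^\perp_\tau=\Pi_\sigma$, i.e. $\Pi^\perp_{a,b}(\tau)=\Pi_{a,b}(\sigma)$ for every $(a,b)\in\mathit{dep}$.
   Context: A comtrace alphabet is $\Theta=(\Sigma,\mathit{sim},\mathit{ser})$ with $\Sigma$ finite nonempty, $\mathit{ser}\subseteq\mathit{sim}\subseteq\Sigma\times\Sigma$, $\mathit{sim}$ irreflexive and symmetric; steps are nonempty $A\subseteq\Sigma$ with $(a,b)\in\mathit{sim}$ for distinct $a,b\in A$; comtraces are classes of the reflexive, symmetric, transitive closure of $uABz\sim u(A\cup B)z$ for steps with $A\times B\subseteq\mathit{ser}$. $\mathit{dep}=(\Sigma\times\Sigma)\setminus\mathit{sim}$, $\mathit{ind}=\mathit{ser}\cap\mathit{ser}^{-1}$, $\mathit{ssm}=\mathit{sim}\setminus(\mathit{ser}\cup\mathit{ser}^{-1})$, $\mathit{wdp}=\mathit{ser}^{-1}\setminus\mathit{ser}$. Comtrace projections (fresh symbol $\perp$): for $(a,b)\notin\mathit{ind}$ and step $A$, $\Pi^\perp_{a,b}(A)=\epsilon$ if $\{a,b\}\cap A=\emptyset$;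 $a$ if $a\in A,b\notin A$; $b$ if $b\in A,a\notin A$; $a$ if $a=b\in A$; for distinct $a,b\in A$: $ba$ if $(a,b)\in\mathit{wdp}$, $ab$ if $(b,a)\in\mathit{wdp}$, $\perp$ if $(a,b)\in\mathit{ssm}$; concatenated over steps, and $\Pi^\perp_\tau(a,b)=\Pi^\perp_{a,b}(w)$ for $w\in\tau$. Step traces over a concurrent alphabet $(\Sigma,I)$ ($I$ irreflexive symmetric): steps are nonempty sets of pairwise $I$-related actions, and step traces are classes of the reflexive, symmetric, transitive closure of $uABz\sim u(A\cup B)z$ for $A\times B\subseteq I$. For $(a,b)$ not in $I$ (possibly $a=b$), $\Pi_{a,b}$ maps a step sequence to a word: $\Pi_{a,b}(Aw)=a\Pi_{a,b}(w)$ if $a\in A$, $b\Pi_{a,b}(w)$ if $b\in A$, $\Pi_{a,b}(w)$ otherwise, and $\Pi_{a,b}(\text{empty})=\epsilon$; $\Pi_\sigma(a,b)=\Pi_{a,b}(w)$ for $w\in\sigma$. *)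

theory Defs
  imports Main
begin

definition comtrace_alphabet :: "'a set \<Rightarrow> ('a \<times> 'a) set \<Rightarrow> ('a \<times> 'a) set \<Rightarrow> bool" where
  "comtrace_alphabet \<Sigma> sim ser \<longleftrightarrow>
     finite \<Sigma> \<and> \<Sigma> \<noteq> {} \<and> ser \<subseteq> sim \<and> sim \<subseteq> \<Sigma> \<times> \<Sigma> \<and> irrefl sim \<and> sym sim"

definition dep :: "'a set \<Rightarrow> ('a \<times> 'a) set \<Rightarrow> ('a \<times> 'a) set" where
  "dep \<Sigma> sim = (\<Sigma> \<times> \<Sigma>) - sim"

definition ind :: "('a \<times> 'a) set \<Rightarrow> ('a \<times> 'a) set" where
  "ind ser = ser \<inter> ser\<inverse>"

definition ssm :: "('a \<times> 'a) set \<Rightarrow> ('a \<times> 'a) set \<Rightarrow> ('a \<times> 'a) set" where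
  "ssm sim ser = sim - (ser \<union> ser\<inverse>)"

definition wdp :: "('a \<times> 'a) set \<Rightarrow> ('a \<times> 'a) set" where
  "wdp ser = ser\<inverse> - ser"

definition steps :: "'a set \<Rightarrow> ('a \<times> 'a) set \<Rightarrow> 'a set set" where
  "steps \<Sigma> R = {A. A \<noteq> {} \<and> A \<subseteq> \<Sigma> \<and> (\<forall>a\<in>A. \<forall>b\<in>A. a \<noteq> b \<longrightarrow> (a, b) \<in> R)}"

text \<open>The generating relation shared by comtraces and step traces: \<open>R\<close> determines which sets
  are steps, and \<open>Q\<close> which steps may be split. Comtraces take \<open>R = sim\<close> and \<open>Q = ser\<close>; step traces
  over \<open>(\<Sigma>, I)\<close> take \<open>R = Q = I\<close>.\<close>

inductive step_split ::
  "'a set \<Rightarrow> ('a \<times> 'a) set \<Rightarrow> ('a \<times> 'a) set \<Rightarrow> 'a set list \<Rightarrow> 'a set list \<Rightarrow> bool"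
  for \<Sigma> R Q where
  "\<lbrakk>u \<in> lists (steps \<Sigma> R); z \<in> lists (steps \<Sigma> R); A \<in> steps \<Sigma> R; B \<in> steps \<Sigma> R; A \<times> B \<subseteq> Q\<rbrakk>
     \<Longrightarrow> step_split \<Sigma> R Q (u @ [A, B] @ z) (u @ [A \<union> B] @ z)"

definition step_equiv ::
  "'a set \<Rightarrow> ('a \<times> 'a) set \<Rightarrow> ('a \<times> 'a) set \<Rightarrow> ('a set list \<times> 'a set list) set" where
  "step_equiv \<Sigma> R Q = {(v, w). v \<in> lists (steps \<Sigma> R) \<and> w \<in> lists (steps \<Sigma> R) \<and>
                               equivclp (step_split \<Sigma> R Q) v w}"

definition comtraces ::
  "'a set \<Rightarrow> ('a \<times> 'a) set \<Rightarrow> ('a \<times> 'a) set \<Rightarrow> 'a set list set set" where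
  "comtraces \<Sigma> sim ser = lists (steps \<Sigma> sim) // step_equiv \<Sigma> sim ser"

definition step_traces :: "'a set \<Rightarrow> ('a \<times> 'a) set \<Rightarrow> 'a set list set set" where
  "step_traces \<Sigma> I = lists (steps \<Sigma> I) // step_equiv \<Sigma> I I"

text \<open>Words over the alphabet extended by the fresh symbol \<open>\<bottom>\<close> are modelled as \<open>'a option list\<close>,
  with \<open>None\<close> for \<open>\<bottom>\<close>. The final \<open>undefined\<close> is never reached when \<open>A\<close> is a step and
  \<open>(a, b) \<notin> ind ser\<close>.\<close>

definition comtrace_proj_step ::
  "('a \<times> 'a) set \<Rightarrow> ('a \<times> 'a) set \<Rightarrow> 'a \<Rightarrow> 'a \<Rightarrow> 'a set \<Rightarrow> 'a option list" where
  "comtrace_proj_step sim ser a b A =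
     (if a \<notin> A \<and> b \<notin> A then []
      else if a \<in> A \<and> b \<notin> A then [Some a]
      else if b \<in> A \<and> a \<notin> A then [Some b]
      else if a = b then [Some a]
      else if (a, b) \<in> wdp ser then [Some b, Some a]
      else if (b, a) \<in> wdp ser then [Some a, Some b]
      else if (a, b) \<in> ssm sim ser then [None]
      else undefined)"

definition comtrace_proj_seq ::
  "('a \<times> 'a) set \<Rightarrow> ('a \<times> 'a) set \<Rightarrow> 'a \<Rightarrow> 'a \<Rightarrow> 'a set list \<Rightarrow> 'a option list" where
  "comtrace_proj_seq sim ser a b w = concat (map (comtrace_proj_step sim ser a b) w)"

primrec step_proj_seq :: "'a \<Rightarrow> 'a \<Rightarrow> 'a set list \<Rightarrow> 'a list" where
  "step_proj_seq a b [] = []"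
| "step_proj_seq a b (A # w) =
     (if a \<in> A then a # step_proj_seq a b w
      else if b \<in> A then b # step_proj_seq a b w
      else step_proj_seq a b w)"

text \<open>The projection of a class is the common value of the projection on its members; with
  \<open>the_elem\<close> it is only meaningful when that value is unique.\<close>

definition comtrace_proj ::
  "('a \<times> 'a) set \<Rightarrow> ('a \<times> 'a) set \<Rightarrow> 'a set list set \<Rightarrow> 'a \<Rightarrow> 'a \<Rightarrow> 'a option list" where
  "comtrace_proj sim ser \<tau> a b = the_elem (comtrace_proj_seq sim ser a b ` \<tau>)"

definition step_trace_proj :: "'a set list set \<Rightarrow> 'a \<Rightarrow> 'a \<Rightarrow> 'a list" where
  "step_trace_proj \<sigma> a b = the_elem (step_proj_seq a b ` \<sigma>)"

end

theory Submission
  imports Defs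
begin

text \<open>If \<open>sim \<subseteq> ser\<close>, then \<open>ser = sim\<close> is symmetric, so \<open>ind = sim\<close> and comtraces are literally step
  traces over \<open>(\<Sigma>, ind)\<close>. Two distinct dependent actions never occur together in a step, so both
  projections agree on every step sequence. Moreover, if \<open>A \<times> B \<subseteq> ser\<close>, then at most one of \<open>A\<close> and
  \<open>B\<close> meets a given dependent pair, so replacing \<open>A B\<close> by \<open>A \<union> B\<close> does not change the projection.\<close>

lemma equiv_step_equiv: "equiv (lists (steps \<Sigma> R)) (step_equiv \<Sigma> R Q)"
proof (rule equivI)
  show "step_equiv \<Sigma> R Q \<subseteq> lists (steps \<Sigma> R) \<times> lists (steps \<Sigma> R)"
    by (auto simp: step_equiv_def)
  show "refl_on (lists (steps \<Sigma> R)) (step_equiv \<Sigma> R Q)"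
    by (auto simp: refl_on_def step_equiv_def)
  show "sym (step_equiv \<Sigma> R Q)"
    by (auto simp: sym_def step_equiv_def intro: equivclp_sym)
  show "trans (step_equiv \<Sigma> R Q)"
    by (auto simp: trans_def step_equiv_def intro: equivclp_trans)
qed

lemma comtrace_nonempty: "\<tau> \<in> comtraces \<Sigma> R Q \<Longrightarrow> \<tau> \<noteq> {}"
  unfolding comtraces_def by (rule in_quotient_imp_non_empty[OF equiv_step_equiv])

lemma comtrace_subset_lists_steps: "\<tau> \<in> comtraces \<Sigma> R Q \<Longrightarrow> \<tau> \<subseteq> lists (steps \<Sigma> R)"
  unfolding comtraces_def by (rule in_quotient_imp_subset[OF equiv_step_equiv])

lemma comtrace_imp_step_equiv:
  "\<lbrakk>\<tau> \<in> comtraces \<Sigma> R Q; v \<in> \<tau>; w \<in> \<tau>\<rbrakk> \<Longrightarrow> (v, w) \<in> step_equiv \<Sigma> R Q"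
  unfolding comtraces_def using quotient_eq_iff[OF equiv_step_equiv] by blast

lemma comtraces_meet_iff_eq:
  assumes "\<sigma> \<in> comtraces \<Sigma> R Q" "\<tau> \<in> comtraces \<Sigma> R Q"
  shows "(\<exists>w\<in>\<tau>. w \<in> \<sigma>) \<longleftrightarrow> \<sigma> = \<tau>"
  using quotient_disj[OF equiv_step_equiv assms[unfolded comtraces_def]]
    comtrace_nonempty[OF assms(2)] by blast

lemma step_traces_eq_comtraces: "step_traces \<Sigma> I = comtraces \<Sigma> I I"
  by (simp add: step_traces_def comtraces_def)

lemma step_proj_seq_append:
  "step_proj_seq a b (u @ v) = step_proj_seq a b u @ step_proj_seq a b v"
  by (induction u) auto

lemma step_proj_seq_step_split:
  assumes "step_split \<Sigma> R Q v w" "{a, b} \<times> {a, b} \<inter> Q = {}"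
  shows "step_proj_seq a b v = step_proj_seq a b w"
proof -
  obtain u z A B where v: "v = u @ [A, B] @ z" and w: "w = u @ [A \<union> B] @ z" and "A \<times> B \<subseteq> Q"
    using assms(1) by cases
  then consider "{a, b} \<inter> A = {}" | "{a, b} \<inter> B = {}"
    using assms(2) by blast
  then have "step_proj_seq a b [A, B] = step_proj_seq a b [A \<union> B]"
    by cases simp_all
  then show ?thesis
    by (simp only: v w step_proj_seq_append)
qed

lemma step_proj_seq_step_equiv:
  assumes "(v, w) \<in> step_equiv \<Sigma> R Q" "{a, b} \<times> {a, b} \<inter> Q = {}"
  shows "step_proj_seq a b v = step_proj_seq a b w"
proof -
  have "equivclp (step_split \<Sigma> R Q) v w"
    using assms(1) by (simp add: step_equiv_def)
  then show ?thesis
    by (induction rule: equivclp_induct) (auto dest: step_proj_seq_step_split[OF _ assms(2)])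
qed

lemma comtrace_proj_seq_eq_map_step_proj_seq:
  assumes "w \<in> lists (steps \<Sigma> sim)" "(a, b) \<notin> sim"
  shows "comtrace_proj_seq sim ser a b w = map Some (step_proj_seq a b w)"
  using assms(1)
proof induction
  case (Cons A w)
  have "a = b" if "a \<in> A" "b \<in> A"
    using Cons.hyps(1) assms(2) that by (auto simp: steps_def)
  with Cons.IH show ?case
    by (auto simp: comtrace_proj_seq_def comtrace_proj_step_def)
qed (simp add: comtrace_proj_seq_def)

lemma step_trace_proj_eq_step_proj_seq:
  assumes "\<sigma> \<in> step_traces \<Sigma> I" "w \<in> \<sigma>" "{a, b} \<times> {a, b} \<inter> I = {}"
  shows "step_trace_proj \<sigma> a b = step_proj_seq a b w"
  unfolding step_trace_proj_def
proof (rule the_elem_image_unique)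
  show "\<sigma> \<noteq> {}"
    using assms(2) by blast
  fix v assume "v \<in> \<sigma>"
  then have "(v, w) \<in> step_equiv \<Sigma> I I"
    using assms(1,2) by (simp add: step_traces_eq_comtraces comtrace_imp_step_equiv)
  then show "step_proj_seq a b v = step_proj_seq a b w"
    using assms(3) by (rule step_proj_seq_step_equiv)
qed

lemma comtrace_proj_eq_map_step_proj_seq:
  assumes "\<tau> \<in> comtraces \<Sigma> sim ser" "w \<in> \<tau>" "(a, b) \<notin> sim" "{a, b} \<times> {a, b} \<inter> ser = {}"
  shows "comtrace_proj sim ser \<tau> a b = map Some (step_proj_seq a b w)"
proof -
  have seq: "comtrace_proj_seq sim ser a b v = map Some (step_proj_seq a b v)" if "v \<in> \<tau>" for v
    using comtrace_subset_lists_steps[OF assms(1)] that assms(3)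
    by (blast intro: comtrace_proj_seq_eq_map_step_proj_seq)
  have "comtrace_proj sim ser \<tau> a b = comtrace_proj_seq sim ser a b w"
    unfolding comtrace_proj_def
  proof (rule the_elem_image_unique)
    show "\<tau> \<noteq> {}"
      using assms(2) by blast
    fix v assume "v \<in> \<tau>"
    then have "(v, w) \<in> step_equiv \<Sigma> sim ser"
      using comtrace_imp_step_equiv assms(1,2) by blast
    then have "step_proj_seq a b v = step_proj_seq a b w"
      using assms(4) by (rule step_proj_seq_step_equiv)
    then show "comtrace_proj_seq sim ser a b v = comtrace_proj_seq sim ser a b w"
      by (simp add: seq \<open>v \<in> \<tau>\<close> assms(2))
  qed
  then show ?thesis
    by (simp add: seq assms(2))
qed

lemma dep_square_disjoint_ser:
  assumes "comtrace_alphabet \<Sigma> sim ser" "(a, b) \<in> dep \<Sigma> sim"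
  shows "{a, b} \<times> {a, b} \<inter> ser = {}"
  using assms by (auto simp: comtrace_alphabet_def dep_def irrefl_def dest: symD)

lemma comtrace_proj_eq_step_trace_proj:
  assumes "comtrace_alphabet \<Sigma> sim ser" "(a, b) \<in> dep \<Sigma> sim"
    and "\<tau> \<in> comtraces \<Sigma> sim ser" "\<sigma> \<in> step_traces \<Sigma> (ind ser)" "w \<in> \<tau>" "w \<in> \<sigma>"
  shows "comtrace_proj sim ser \<tau> a b = map Some (step_trace_proj \<sigma> a b)"
proof -
  have ser: "{a, b} \<times> {a, b} \<inter> ser = {}"
    using assms(1,2) by (rule dep_square_disjoint_ser)
  then have ind: "{a, b} \<times> {a, b} \<inter> ind ser = {}"
    unfolding ind_def by blast
  have "(a, b) \<notin> sim"
    using assms(2) by (simp add: dep_def)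
  with assms(3,5) have "comtrace_proj sim ser \<tau> a b = map Some (step_proj_seq a b w)"
    using ser by (rule comtrace_proj_eq_map_step_proj_seq)
  also have "step_proj_seq a b w = step_trace_proj \<sigma> a b"
    using assms(4,6) ind by (rule step_trace_proj_eq_step_proj_seq[symmetric])
  finally show ?thesis .
qed

lemma radical_ind_eq_sim:
  "\<lbrakk>comtrace_alphabet \<Sigma> sim ser; sim - ser = {}\<rbrakk> \<Longrightarrow> ind ser = sim"
  by (auto simp: comtrace_alphabet_def ind_def dest: symD)

lemma radical_comtraces_eq_step_traces:
  assumes "comtrace_alphabet \<Sigma> sim ser" "sim - ser = {}"
  shows "comtraces \<Sigma> sim ser = step_traces \<Sigma> (ind ser)"
proof -
  have "ser = sim"
    using assms by (auto simp: comtrace_alphabet_def)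
  then show ?thesis
    using radical_ind_eq_sim[OF assms] by (simp add: step_traces_eq_comtraces)
qed

theorem theorem4p13:
  fixes \<Sigma> :: "'a set" and sim ser :: "('a \<times> 'a) set" and \<tau> :: "'a set list set"
  assumes "comtrace_alphabet \<Sigma> sim ser"
    and "sim - ser = {}"
    and "\<tau> \<in> comtraces \<Sigma> sim ser"
  shows "(\<Sigma> \<times> \<Sigma>) - ind ser = dep \<Sigma> sim \<and>
    (\<exists>!\<sigma>. \<sigma> \<in> step_traces \<Sigma> (ind ser) \<and> (\<exists>w\<in>\<tau>. w \<in> \<sigma>)) \<and>
    (\<forall>\<sigma>\<in>step_traces \<Sigma> (ind ser).
       ((\<exists>w\<in>\<tau>. w \<in> \<sigma>) \<longleftrightarrow> (\<forall>w\<in>\<tau>. w \<in> \<sigma>)) \<and>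
       ((\<exists>w\<in>\<tau>. w \<in> \<sigma>) \<longrightarrow>
          (\<forall>(a, b)\<in>dep \<Sigma> sim.
             comtrace_proj sim ser \<tau> a b = map Some (step_trace_proj \<sigma> a b))))"
proof -
  have traces: "comtraces \<Sigma> sim ser = step_traces \<Sigma> (ind ser)"
    using assms(1,2) by (rule radical_comtraces_eq_step_traces)
  have meet: "(\<exists>w\<in>\<tau>. w \<in> \<sigma>) \<longleftrightarrow> \<sigma> = \<tau>" if "\<sigma> \<in> step_traces \<Sigma> (ind ser)" for \<sigma>
    using comtraces_meet_iff_eq[OF _ assms(3)] that by (simp add: traces)
  have "\<Sigma> \<times> \<Sigma> - ind ser = dep \<Sigma> sim"
    by (simp add: dep_def radical_ind_eq_sim[OF assms(1,2)])
  moreover have "\<exists>!\<sigma>. \<sigma> \<in> step_traces \<Sigma> (ind ser) \<and> (\<exists>w\<in>\<tau>. w \<in> \<sigma>)"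
    using assms(3) by (auto simp: traces meet cong: conj_cong)
  moreover have "(\<exists>w\<in>\<tau>. w \<in> \<sigma>) \<longleftrightarrow> (\<forall>w\<in>\<tau>. w \<in> \<sigma>)" if "\<sigma> \<in> step_traces \<Sigma> (ind ser)" for \<sigma>
    using meet[OF that] comtrace_nonempty[OF assms(3)] by blast
  moreover have "\<forall>(a, b)\<in>dep \<Sigma> sim.
      comtrace_proj sim ser \<tau> a b = map Some (step_trace_proj \<sigma> a b)"
    if "\<sigma> \<in> step_traces \<Sigma> (ind ser)" "\<exists>w\<in>\<tau>. w \<in> \<sigma>" for \<sigma>
    using that comtrace_proj_eq_step_trace_proj[OF assms(1) _ assms(3) that(1)] by blast
  ultimately show ?thesis
    by simp
qed

end
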